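(* Let $d\geq 1$ and let $\mathcal{T}\in \operatorname{End}(\mathbb{R}^d)$ be a linear operator. (1) If $\mathcal{T}$ is diagonalizable over $\mathbb{C}$, then there exists a convex compact set $K\subset\mathbb{R}^d$ with $\mu(K)>0$ such that $\mu(K+\mathcal{T}K)=H(\mathcal{T})\cdot\mu(K)$. (2) For general $\mathcal{T}$, there exists a sequence of convex compact sets $K_n\subset\mathbb{R}^d$ with $\mu(K_n)>0$ such that $$\lim_{n\to\infty}\frac{\mu(K_n+\mathcal{T}K_n)}{\mu(K_n)}=H(\mathcal{T}).$$
   Context: $\mu$ is the Lebesgue measure in $\mathbb{R}^d$. $K+\mathcal{T}K=\{x+\mathcal{T}y : x,y\in K\}$. For a linear operator $\mathcal{T}\in\operatorname{End}(\mathbb{R}^d)$ (over $\mathbb{R}$), $H(\mathcal{T})=\prod_{i=1}^d(1+|\lambda_i|)$, where $\lambda_1,\ldots,\lambda_d$ are the complex eigenvalues of $\mathcal{T}$ listed with algebraic multiplicities. *)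

theory Defs
  imports "HOL-Analysis.Analysis" "HOL-Computational_Algebra.Computational_Algebra"
begin

definition charpoly :: "'a::comm_ring_1 ^ 'n ^ 'n \<Rightarrow> 'a poly" where
  "charpoly A = det (mat [:0, 1:] - map_matrix (\<lambda>a. [:a:]) A)"

definition complexified_matrix :: "(real ^ 'n \<Rightarrow> real ^ 'n) \<Rightarrow> complex ^ 'n ^ 'n" where
  "complexified_matrix T = map_matrix complex_of_real (matrix T)"

definition complex_eigenvalues :: "(real ^ 'n \<Rightarrow> real ^ 'n) \<Rightarrow> complex multiset" where
  "complex_eigenvalues T = proots (charpoly (complexified_matrix T))"

definition H_factor :: "(real ^ 'n \<Rightarrow> real ^ 'n) \<Rightarrow> real" where
  "H_factor T = (\<Prod>z\<in>#complex_eigenvalues T. 1 + cmod z)"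

definition diagonalizable_over_complex :: "(real ^ 'n \<Rightarrow> real ^ 'n) \<Rightarrow> bool" where
  "diagonalizable_over_complex T \<longleftrightarrow>
     (\<exists>P D :: complex ^ 'n ^ 'n. invertible P \<and> (\<forall>i j. i \<noteq> j \<longrightarrow> D $ i $ j = 0) \<and>
        complexified_matrix T = P ** D ** matrix_inv P)"

definition sum_with_image :: "(real ^ 'n \<Rightarrow> real ^ 'n) \<Rightarrow> (real ^ 'n) set \<Rightarrow> (real ^ 'n) set" where
  "sum_with_image T K = {x + T y | x y. x \<in> K \<and> y \<in> K}"

end

theory Submission
  imports Defs "Jordan_Normal_Form.Jordan_Normal_Form_Existence"
begin

text \<open>Over the complex numbers write \<open>T = P J P\<inverse>\<close> with \<open>J\<close> in Jordan form, diagonal if \<open>T\<close> is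
  diagonalizable, and let \<open>K\<close> be the set of real \<open>v\<close> all of whose coordinates \<open>(P\<inverse> v)\<^sub>i\<close> lie in the unit
  disc. For a function \<open>g\<close> commuting with conjugation, the matrix \<open>P diag(g \<lambda>\<^sub>i) P\<inverse>\<close> is real, whatever
  the choice of \<open>P\<close>. With \<open>g z = 1 + \<bar>z\<bar>\<close> this gives a real map \<open>S\<close> of determinant \<open>H(T)\<close>, and \<open>S K\<close> is the
  set where \<open>\<bar>(P\<inverse> v)\<^sub>i\<bar> \<le> 1 + \<bar>\<lambda>\<^sub>i\<bar>\<close>. If \<open>J\<close> is diagonal, \<open>K + T K = S K\<close>: the inclusion from right to left
  takes \<open>y = U u\<close>, where \<open>U\<close> comes from \<open>g z = cnj (sgn z)\<close>, so that \<open>S u = u + T y\<close>. If the off-diagonal row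
  sums of \<open>J\<close> are at most \<open>e\<close>, both inclusions survive up to dilation by \<open>1 + e\<close>, and conjugating with
  \<open>diag(t\<^sup>i)\<close> for small \<open>t\<close> makes \<open>e\<close> arbitrarily small.\<close>

hide_const (open) Matrix.mat Matrix.row Matrix.col Determinant.det
hide_type (open) Matrix.vec
no_notation fps_nth (infixl \<open>$\<close> 75)
no_notation Matrix.vec_index (infixl \<open>$\<close> 100)
hide_fact (open) Determinant.det_permute_rows Matrix.vec_eq_iff Matrix.mat_def Matrix.row_def Matrix.col_def Determinant.det_def

section \<open>Determinants and linear images\<close>

text \<open>A permutation \<open>p\<close> with a nonzero product satisfies
  \<open>r i \<le> r (p i)\<close> everywhere. Both sides have the same total over
  \<open>UNIV\<close>, so they agree, and injectivity of \<open>r\<close> forces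
  \<open>p = id\<close>. The rank \<open>r\<close> replaces an order on the index type, which is
  only finite.\<close>

lemma det_upper_triangular_wrt:
  fixes A :: "'a::comm_ring_1 ^ 'n ^ 'n" and r :: "'n \<Rightarrow> nat"
  assumes r: "inj r" and tri: "\<And>i j. A $ i $ j \<noteq> 0 \<Longrightarrow> r i \<le> r j"
  shows "det A = (\<Prod>i\<in>UNIV. A $ i $ i)"
proof -
  have zero: "(\<Prod>i\<in>UNIV. A $ i $ p i) = 0" if p: "p permutes UNIV" "p \<noteq> id" for p
  proof (rule ccontr)
    assume nz: "\<not> ?thesis"
    have le: "r i \<le> r (p i)" for i
    proof (rule tri)
      show "A $ i $ p i \<noteq> 0"
        using nz by (metis UNIV_I finite prod_zero)
    qed
    have "(\<Sum>i\<in>UNIV. r (p i)) = (\<Sum>i\<in>UNIV. r i)"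
      using sum.permute[OF p(1), of r] by (simp add: o_def)
    then have "r i = r (p i)" for i
      using sum_mono_inv[of r UNIV "\<lambda>i. r (p i)" i] le by simp
    then show False
      using r p(2) by (auto simp: inj_def fun_eq_iff)
  qed
  have "det A = (\<Sum>p\<in>{p::'n \<Rightarrow> 'n. p permutes UNIV}. if p = id then (\<Prod>i\<in>UNIV. A $ i $ i) else 0)"
    unfolding det_def by (intro sum.cong refl) (auto simp: zero)
  then show ?thesis
    by (simp add: permutes_id finite_permutations)
qed

lemma det_diagonal_UNIV:
  fixes f :: "'n::finite \<Rightarrow> 'a::comm_ring_1"
  shows "det (\<chi> i j. if i = j then f i else 0) = (\<Prod>i\<in>UNIV. f i)"
  by (subst det_diagonal) auto

lemma det_map_of_real: "det (map_matrix complex_of_real A) = complex_of_real (det A)"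
  by (simp add: det_def)

section \<open>Volume under elementary and then arbitrary linear maps\<close>

lemma measure_shear_cbox:
  fixes a b :: "real ^ 'n"
  assumes "m \<noteq> n"
  shows "measure lebesgue ((\<lambda>v. \<chi> i. if i = m then v $ m + v $ n else v $ i) ` cbox a b)
         = measure lebesgue (cbox a b)"
proof (cases "cbox a b = {}")
  case False
  let ?h = "\<lambda>v::real ^ 'n. \<chi> i. if i = m then v $ m + v $ n else v $ i"
  \<comment> \<open>Translating by \<open>w\<close> moves the lower \<open>n\<close>-coordinate of
    the box to 0, as \<open>measure_shear_interval\<close> needs it nonnegative. By linearity the
    image is merely translated too.\<close>
  define w :: "real ^ 'n" where "w = (\<chi> i. if i = n then - a $ n else 0)"
  have "?h ` cbox (w + a) (w + b) = ?h ` ((+) w ` cbox a b)"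
    by (simp add: cbox_translation)
  also have "\<dots> = (+) (?h w) ` (?h ` cbox a b)"
    unfolding image_image by (intro image_cong refl) (simp add: vec_eq_iff)
  finally have "measure lebesgue (?h ` cbox a b) = measure lebesgue (?h ` cbox (w + a) (w + b))"
    by (simp add: measure_translation)
  also have "\<dots> = measure lebesgue (cbox (w + a) (w + b))"
  proof (rule measure_shear_interval)
    show "cbox (w + a) (w + b) \<noteq> {}"
      using False by (metis cbox_translation image_is_empty)
    show "0 \<le> (w + a) $ n"
      by (simp add: w_def)
  qed (rule assms)
  also have "\<dots> = measure lebesgue (cbox a b)"
    by (metis cbox_translation measure_translation)
  finally show ?thesis .
qed simp

text \<open>The matrix arises from the identity by adding row \<open>n\<close> to row
  \<open>m\<close>.\<close>

lemma det_shear: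
  assumes "m \<noteq> n"
  shows "det (matrix (\<lambda>v::real ^ 'n. \<chi> i. if i = m then v $ m + v $ n else v $ i)) = 1"
proof -
  have "matrix (\<lambda>v::real ^ 'n. \<chi> i. if i = m then v $ m + v $ n else v $ i)
      = (\<chi> k. if k = m then row m (mat 1) + 1 *s row n (mat 1) else row k (mat 1))"
    by (auto simp: matrix_def axis_def vec_eq_iff row_def mat_def)
  then show ?thesis
    using det_row_operation[OF assms, of "mat 1 :: real ^ 'n ^ 'n" 1] by simp
qed

lemma measure_coordinate_swap_cbox:
  fixes a b :: "real ^ 'n"
  shows "measure lebesgue ((\<lambda>v. \<chi> i. v $ Transposition.transpose m n i) ` cbox a b)
         = measure lebesgue (cbox a b)"
proof (cases "cbox a b = {}")
  case False
  let ?t = "Transposition.transpose m n"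
  let ?h = "\<lambda>v::real ^ 'n. \<chi> i. v $ ?t i"
  have eq: "?h ` cbox a b = cbox (?h a) (?h b)"
  proof (intro subset_antisym subsetI)
    fix x assume "x \<in> cbox (?h a) (?h b)"
    then have x: "a $ ?t i \<le> x $ i \<and> x $ i \<le> b $ ?t i" for i
      by (simp add: mem_box_cart)
    have "a $ i \<le> ?h x $ i \<and> ?h x $ i \<le> b $ i" for i
      using x[of "?t i"] by simp
    then have "?h x \<in> cbox a b"
      unfolding mem_box_cart by blast
    moreover have "x = ?h (?h x)"
      by (simp add: vec_eq_iff)
    ultimately show "x \<in> ?h ` cbox a b"
      by blast
  qed (auto simp: mem_box_cart)
  have "(\<Prod>i\<in>UNIV. (b - a) $ ?t i) = (\<Prod>i\<in>UNIV. (b - a) $ i)"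
    using prod.permute[OF permutes_swap_id, of m UNIV n "\<lambda>i. (b - a) $ i"] by (simp add: o_def)
  moreover have "cbox (?h a) (?h b) \<noteq> {}"
    using False eq by blast
  ultimately show ?thesis
    using False by (simp add: eq content_cbox_cart)
qed simp

text \<open>The matrix is the identity with rows permuted, so its determinant is the sign of the
  permutation. The absolute value also covers \<open>m = n\<close>.\<close>

lemma det_coordinate_swap:
  "\<bar>det (matrix (\<lambda>v::real ^ 'n. \<chi> i. v $ Transposition.transpose m n i))\<bar> = 1"
proof -
  let ?t = "Transposition.transpose m n"
  have "?t i = j \<longleftrightarrow> i = ?t j" for i j
    by (metis transpose_involutory)
  then have "matrix (\<lambda>v::real ^ 'n. \<chi> i. v $ ?t i) = (\<chi> i. mat 1 $ ?t i)"
    by (auto simp: matrix_def axis_def vec_eq_iff mat_def)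
  moreover have "det (\<chi> i. (mat 1 :: real ^ 'n ^ 'n) $ ?t i) = of_int (sign ?t) * det (mat 1 :: real ^ 'n ^ 'n)"
    by (rule det_permute_rows[OF permutes_swap_id]) simp_all
  ultimately show ?thesis
    by (simp add: sign_swap_id)
qed

text \<open>The library has \<open>measure_linear_image\<close> only for a well-ordered index type.\<close>

proposition measure_linear_image_finite:
  fixes f :: "real ^ 'n \<Rightarrow> real ^ 'n"
  assumes "linear f" "S \<in> lmeasurable"
  shows "f ` S \<in> lmeasurable \<and> measure lebesgue (f ` S) = \<bar>det (matrix f)\<bar> * measure lebesgue S"
proof -
  let ?Q = "\<lambda>f :: real ^ 'n \<Rightarrow> real ^ 'n. \<forall>S\<in>lmeasurable.
    f ` S \<in> lmeasurable \<and> measure lebesgue (f ` S) = \<bar>det (matrix f)\<bar> * measure lebesgue S"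
  have "?Q f"
  proof (rule induct_linear_elementary[OF \<open>linear f\<close>])
    fix f g :: "real ^ 'n \<Rightarrow> real ^ 'n"
    assume lin: "linear f" "linear g" and "?Q f" "?Q g"
    then have Q: "f ` g ` S \<in> lmeasurable \<and> measure lebesgue (f ` g ` S)
      = \<bar>det (matrix f)\<bar> * (\<bar>det (matrix g)\<bar> * measure lebesgue S)" if "S \<in> lmeasurable" for S
      using that by simp
    have "matrix (f \<circ> g) = matrix f ** matrix g"
      using lin by (simp add: matrix_compose)
    then show "?Q (f \<circ> g)"
      using Q by (simp add: image_comp det_mul abs_mult)
  next
    fix f :: "real ^ 'n \<Rightarrow> real ^ 'n" and i
    assume f: "linear f" and 0: "\<And>x. f x $ i = 0"
    have "\<not> surj f"
      using 0 by (metis axis_nth surjD zero_neq_one)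
    then have ninj: "\<not> inj f"
      using f linear_injective_imp_surjective by blast
    then have "negligible (f ` S)" for S
      using f negligible_linear_singular_image by blast
    moreover have "det (matrix f) = 0"
      using ninj f det_nz_iff_inj by blast
    ultimately show "?Q f"
      by (simp add: negligible_iff_measure)
  next
    fix c :: "'n \<Rightarrow> real"
    have "det (matrix (\<lambda>x::real ^ 'n. \<chi> i. c i * x $ i)) = prod c UNIV"
      by (subst det_diagonal) (auto simp: matrix_def axis_def)
    then show "?Q (\<lambda>x. \<chi> i. c i * x $ i)"
      by (simp add: measurable_stretch measure_stretch)
  next
    fix m n :: 'n
    \<comment> \<open>For swaps, and for shears below, preserving the volume of boxes suffices, by
      \<open>measure_linear_sufficient\<close> with factor 1.\<close>
    have lin: "linear (\<lambda>v::real ^ 'n. \<chi> i. v $ Transposition.transpose m n i)"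
      by (rule linearI) (simp_all add: vec_eq_iff)
    show "?Q (\<lambda>v. \<chi> i. v $ Transposition.transpose m n i)"
    proof
      fix S :: "(real ^ 'n) set"
      assume S: "S \<in> lmeasurable"
      show "(\<lambda>v. \<chi> i. v $ Transposition.transpose m n i) ` S \<in> lmeasurable \<and>
          measure lebesgue ((\<lambda>v. \<chi> i. v $ Transposition.transpose m n i) ` S) =
          \<bar>det (matrix (\<lambda>v::real ^ 'n. \<chi> i. v $ Transposition.transpose m n i))\<bar> * measure lebesgue S"
        using measure_linear_sufficient[OF lin S, of 1]
        unfolding det_coordinate_swap measure_coordinate_swap_cbox mult_1 by metis
    qed
  next
    fix m n :: 'n
    assume mn: "m \<noteq> n"
    have lin: "linear (\<lambda>v::real ^ 'n. \<chi> i. if i = m then v $ m + v $ n else v $ i)"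
      by (rule linearI) (simp_all add: vec_eq_iff algebra_simps)
    show "?Q (\<lambda>v. \<chi> i. if i = m then v $ m + v $ n else v $ i)"
    proof
      fix S :: "(real ^ 'n) set"
      assume S: "S \<in> lmeasurable"
      show "(\<lambda>v. \<chi> i. if i = m then v $ m + v $ n else v $ i) ` S \<in> lmeasurable \<and>
          measure lebesgue ((\<lambda>v. \<chi> i. if i = m then v $ m + v $ n else v $ i) ` S) =
          \<bar>det (matrix (\<lambda>v::real ^ 'n. \<chi> i. if i = m then v $ m + v $ n else v $ i))\<bar> * measure lebesgue S"
        using measure_linear_sufficient[OF lin S, of 1]
        unfolding det_shear[OF mn] measure_shear_cbox[OF mn] mult_1 abs_one by metis
    qed
  qed
  with assms(2) show ?thesis
    by blast
qed

section \<open>Eigenvalues of a triangularised operator\<close>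

lemma map_matrix_mult:
  fixes A :: "'a::semiring_1 ^ 'm ^ 'k" and B :: "'a ^ 'n ^ 'm" and f :: "'a \<Rightarrow> 'b::semiring_1"
  assumes "f 0 = 0" "\<And>x y. f (x + y) = f x + f y" "\<And>x y. f (x * y) = f x * f y"
  shows "map_matrix f (A ** B) = map_matrix f A ** map_matrix f B"
proof -
  have "f (sum g X) = (\<Sum>x\<in>X. f (g x))" if "finite X" for g :: "'m \<Rightarrow> 'a" and X
    using that assms by induction auto
  then show ?thesis
    by (simp add: matrix_matrix_mult_def vec_eq_iff assms(3))
qed

lemma matrix_mult_diff_distrib:
  fixes A B :: "'a::ring_1 ^ 'm ^ 'k" and C :: "'a ^ 'n ^ 'm" and D :: "'a ^ 'k ^ 'n"
  shows "(A - B) ** C = A ** C - B ** C" "D ** (A - B) = D ** A - D ** B"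
  by (simp_all add: matrix_matrix_mult_def vec_eq_iff algebra_simps sum_subtractf)

text \<open>The scalar matrix \<open>?X\<close> commutes with \<open>?C P\<close>, so
  \<open>?C P\<close> can be moved across the characteristic matrix. Its determinant is nonzero and
  cancels, polynomials over an integral domain being one again.\<close>

lemma charpoly_similar:
  fixes P J :: "'a::idom ^ 'n ^ 'n"
  assumes "P ** P' = mat 1" "P' ** P = mat 1"
  shows "charpoly (P ** J ** P') = charpoly J"
proof -
  let ?C = "map_matrix (\<lambda>a::'a. [:a:]) :: 'a ^ 'n ^ 'n \<Rightarrow> _" and ?X = "mat [:0, 1:] :: 'a poly ^ 'n ^ 'n"
  have C: "?C (A ** B) = ?C A ** ?C B" for A B
    by (rule map_matrix_mult) auto
  have one: "?C (mat 1) = mat 1"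
    by (auto simp: vec_eq_iff mat_def)
  have X: "?X ** A = A ** ?X" for A
    by (auto simp: vec_eq_iff matrix_matrix_mult_def mat_def if_distrib if_distribR mult.commute
        cong: if_cong)
  have "?C P ** ?C P' = mat 1"
    using assms by (metis C one)
  then have nz: "det (?C P) \<noteq> 0"
    by (metis det_I det_mul mult_zero_left zero_neq_one)
  have "(?X - ?C (P ** J ** P')) ** ?C P = ?C P ** (?X - ?C J)"
    using assms by (simp add: matrix_mult_diff_distrib C[symmetric] X matrix_mul_assoc[symmetric])
  then have "det (?X - ?C (P ** J ** P')) * det (?C P) = det (?C P) * det (?X - ?C J)"
    by (simp only: det_mul[symmetric])
  then have "det (?C P) * charpoly (P ** J ** P') = det (?C P) * charpoly J"
    by (simp only: charpoly_def mult.commute)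
  with nz show ?thesis
    by (simp only: mult_cancel_left simp_thms)
qed

text \<open>Similarity replaces \<open>T\<close> by \<open>J\<close>, whose characteristic matrix is
  triangular in the order \<open>r\<close>. The eigenvalues with multiplicity are therefore the
  diagonal entries.\<close>

lemma H_factor_triangularised:
  fixes T :: "real ^ 'n \<Rightarrow> real ^ 'n" and r :: "'n \<Rightarrow> nat"
  assumes "P ** P' = mat 1" "P' ** P = mat 1" and T: "complexified_matrix T = P ** J ** P'"
    and r: "inj r" and tri: "\<And>i j. J $ i $ j \<noteq> 0 \<Longrightarrow> r i \<le> r j"
  shows "H_factor T = (\<Prod>i\<in>UNIV. 1 + cmod (J $ i $ i))"
proof -
  have "charpoly (complexified_matrix T) = charpoly J"
    unfolding T using assms(1,2) by (rule charpoly_similar)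
  also have "\<dots> = (\<Prod>i\<in>UNIV. [:- J $ i $ i, 1:])"
    unfolding charpoly_def mat_def
    by (subst det_upper_triangular_wrt[OF r]) (use tri in \<open>auto split: if_splits\<close>)
  finally have "complex_eigenvalues T = (\<Sum>i\<in>UNIV. {#J $ i $ i#})"
    by (simp add: complex_eigenvalues_def proots_prod)
  moreover have "(\<Prod>z\<in>#(\<Sum>i\<in>X. {#J $ i $ i#}). 1 + cmod z) = (\<Prod>i\<in>X. 1 + cmod (J $ i $ i))"
    if "finite X" for X
    using that by induction auto
  ultimately show ?thesis
    by (simp add: H_factor_def)
qed

section \<open>Jordan form and a real functional calculus\<close>

text \<open>A direct sum, up to reordering, of triangular blocks with one eigenvalue each. This
  weakening of Jordan form also covers diagonal matrices, and it survives complex conjugation and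
  rescaling by a diagonal matrix.\<close>

definition split_triangular :: "('n \<Rightarrow> nat) \<Rightarrow> 'a::zero ^ 'n ^ 'n \<Rightarrow> bool" where
  "split_triangular r J \<longleftrightarrow> inj r \<and>
     (\<forall>i j. i \<noteq> j \<longrightarrow> J $ i $ j \<noteq> 0 \<longrightarrow> r i < r j \<and> J $ i $ i = J $ j $ j)"

lemma split_triangularD:
  assumes "split_triangular r J" "J $ i $ j \<noteq> 0" "i \<noteq> j"
  shows "r i < r j" "J $ i $ i = J $ j $ j"
  using assms by (auto simp: split_triangular_def)

text \<open>Induction on the blocks: entries linking the first block to the rest vanish, and inside
  a block the diagonal is constant.\<close>

lemma jordan_matrix_off_diagonal:
  fixes n_as :: "(nat \<times> 'a::{zero,one}) list"
  assumes "i < sum_list (map fst n_as)" "j < sum_list (map fst n_as)" "i \<noteq> j"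
    and "jordan_matrix n_as $$ (i, j) \<noteq> 0"
  shows "i < j \<and> jordan_matrix n_as $$ (i, i) = jordan_matrix n_as $$ (j, j)"
  using assms
proof (induction n_as arbitrary: i j)
  case (Cons na n_as)
  obtain n a where na: "na = (n, a)"
    by force
  let ?J = "jordan_matrix n_as"
  consider "i < n" "j < n" | "i < n" "\<not> j < n" | "\<not> i < n" "j < n" | "\<not> i < n" "\<not> j < n"
    by blast
  then show ?case
  proof cases
    case 4
    show ?thesis
    proof -
      have "i - n < j - n \<and> ?J $$ (i - n, i - n) = ?J $$ (j - n, j - n)"
        by (rule Cons.IH) (use Cons.prems 4 in \<open>auto simp: na jordan_matrix_Cons\<close>)
      with 4 Cons.prems show ?thesis
        by (auto simp: na jordan_matrix_Cons)
    qed
  qed (use Cons.prems in \<open>auto simp: na jordan_matrix_Cons jordan_block_def split: if_splits\<close>)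
qed simp

lemma jordan_form_exists:
  fixes A :: "complex ^ 'n ^ 'n"
  obtains P P' J and r :: "'n \<Rightarrow> nat"
  where "P ** P' = mat 1" "P' ** P = mat 1" "A = P ** J ** P'" "split_triangular r J"
proof -
  let ?n = "CARD('n)"
  obtain r :: "'n \<Rightarrow> nat" where r: "bij_betw r UNIV {..<?n}"
    using ex_bij_betw_finite_nat[OF finite[of "UNIV :: 'n set"]] by (metis atLeast0LessThan)
  define h where "h = inv_into UNIV r"
  have inj: "inj r" and rn: "r i < ?n" for i
    using r by (auto simp: bij_betw_def)
  \<comment> \<open>\<open>L\<close> re-indexes number-indexed matrices by \<open>'n\<close> along
    \<open>r\<close>. It respects products and the identity, so it transports the similarity, and
    \<open>r\<close> becomes the triangular order.\<close>
  define L :: "complex mat \<Rightarrow> complex ^ 'n ^ 'n" where "L X = (\<chi> i j. X $$ (r i, r j))" for X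
  have L_mult: "L (X * Y) = L X ** L Y" if "X \<in> carrier_mat ?n ?n" "Y \<in> carrier_mat ?n ?n" for X Y
  proof -
    have "(X * Y) $$ (r i, r j) = (\<Sum>k\<in>UNIV. X $$ (r i, r k) * Y $$ (r k, r j))" for i j
    proof -
      have "(X * Y) $$ (r i, r j) = (\<Sum>k\<in>{..<?n}. X $$ (r i, k) * Y $$ (k, r j))"
        using that rn by (simp add: scalar_prod_def atLeast0LessThan)
      also have "\<dots> = (\<Sum>k\<in>UNIV. X $$ (r i, r k) * Y $$ (r k, r j))"
        by (rule sum.reindex_bij_betw[OF r, symmetric])
      finally show ?thesis .
    qed
    then show ?thesis
      by (simp add: L_def matrix_matrix_mult_def vec_eq_iff)
  qed
  have L_one: "L (1\<^sub>m ?n) = mat 1"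
    using inj rn by (auto simp: L_def vec_eq_iff mat_def inj_def)
  define M where "M = Matrix.mat ?n ?n (\<lambda>(i, j). A $ h i $ h j)"
  have M: "M \<in> carrier_mat ?n ?n"
    by (simp add: M_def)
  have LM: "L M = A"
    using inj rn by (simp add: L_def M_def vec_eq_iff h_def)
  obtain as where "char_poly M = (\<Prod>a\<leftarrow>as. [:- a, 1:])"
    using char_poly_factorized[OF M] by blast
  then obtain n_as where "jordan_nf M n_as"
    using jordan_nf_exists[OF M] by blast
  then obtain P P' where "similar_mat_wit M (jordan_matrix n_as) P P'"
    by (auto simp: jordan_nf_def similar_mat_def)
  then have J: "jordan_matrix n_as \<in> carrier_mat ?n ?n" and P: "P \<in> carrier_mat ?n ?n"
    and P': "P' \<in> carrier_mat ?n ?n" and PP': "P * P' = 1\<^sub>m ?n" "P' * P = 1\<^sub>m ?n"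
    and MP: "M = P * jordan_matrix n_as * P'"
    using M by (auto simp: similar_mat_wit_def Let_def)
  have n: "sum_list (map fst n_as) = ?n"
    using carrier_matD(1)[OF J] by simp
  show thesis
  proof (rule that)
    show "L P ** L P' = mat 1" "L P' ** L P = mat 1"
      by (simp_all only: L_mult[OF P P', symmetric] L_mult[OF P' P, symmetric] PP' L_one)
    show "A = L P ** L (jordan_matrix n_as) ** L P'"
      by (simp only: L_mult[OF P J, symmetric] L_mult[OF mult_carrier_mat[OF P J] P', symmetric] MP[symmetric] LM)
    show "split_triangular r (L (jordan_matrix n_as))"
      unfolding split_triangular_def
    proof (intro conjI allI impI inj)
      fix i j assume "i \<noteq> j" "L (jordan_matrix n_as) $ i $ j \<noteq> 0"
      then have "r i < r j \<and> jordan_matrix n_as $$ (r i, r i) = jordan_matrix n_as $$ (r j, r j)"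
        using inj rn by (intro jordan_matrix_off_diagonal) (auto simp: L_def n inj_def)
      then show "r i < r j" "L (jordan_matrix n_as) $ i $ i = L (jordan_matrix n_as) $ j $ j"
        by (auto simp: L_def)
    qed
  qed
qed

section \<open>Conjugation symmetry of the eigencoordinates\<close>

text \<open>In entry \<open>(i, j)\<close> of \<open>J ** Q = Q ** M\<close> every non-diagonal term
  contains an entry of \<open>Q\<close> with the same pair of distinct eigenvalues, zero by
  induction. What remains says that the eigenvalue difference times \<open>Q $ i $ j\<close> is
  0.\<close>

lemma intertwiner_entry_zero:
  fixes J M Q :: "complex ^ 'n ^ 'n"
  assumes J: "split_triangular r J" and M: "split_triangular r M" and Q: "J ** Q = Q ** M"
    and "J $ i $ i \<noteq> M $ j $ j"
  shows "Q $ i $ j = 0"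
  using assms(4)
\<comment> \<open>The measure drops when \<open>i\<close> moves up along a row of \<open>J\<close>
  or \<open>j\<close> moves down along a column of \<open>M\<close>.\<close>
proof (induction "(Max (range r) - r i) + r j" arbitrary: i j rule: less_induct)
  case less
  have le: "r k \<le> Max (range r)" for k
    by simp
  have "J $ i $ k * Q $ k $ j = 0" if "k \<noteq> i" for k
  proof (cases "J $ i $ k = 0")
    case False
    have "r i < r k" "J $ k $ k = J $ i $ i"
      using split_triangularD[OF J False] that by auto
    then have "Max (range r) - r k + r j < Max (range r) - r i + r j"
      using le[of k] by arith
    then have "Q $ k $ j = 0"
      using less(2) \<open>J $ k $ k = J $ i $ i\<close> by (intro less(1)) auto
    then show ?thesis
      by simp
  qed simp
  then have "(\<Sum>k\<in>UNIV. J $ i $ k * Q $ k $ j) = (\<Sum>k\<in>{i}. J $ i $ k * Q $ k $ j)"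
    by (intro sum.mono_neutral_right) auto
  moreover have "Q $ i $ k * M $ k $ j = 0" if "k \<noteq> j" for k
  proof (cases "M $ k $ j = 0")
    case False
    have "r k < r j" "M $ k $ k = M $ j $ j"
      using split_triangularD[OF M False] that by auto
    have "Max (range r) - r i + r k < Max (range r) - r i + r j"
      using \<open>r k < r j\<close> by (rule add_strict_left_mono)
    then have "Q $ i $ k = 0"
      using less(2) \<open>M $ k $ k = M $ j $ j\<close> by (intro less(1)) auto
    then show ?thesis
      by simp
  qed simp
  then have "(\<Sum>k\<in>UNIV. Q $ i $ k * M $ k $ j) = (\<Sum>k\<in>{j}. Q $ i $ k * M $ k $ j)"
    by (intro sum.mono_neutral_right) auto
  moreover have "(\<Sum>k\<in>UNIV. J $ i $ k * Q $ k $ j) = (\<Sum>k\<in>UNIV. Q $ i $ k * M $ k $ j)"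
    using Q by (simp add: matrix_matrix_mult_def vec_eq_iff)
  ultimately have "J $ i $ i * Q $ i $ j = M $ j $ j * Q $ i $ j"
    by auto
  then show ?case
    using less(2) by simp
qed

text \<open>The matrix \<open>P'\<close> times the conjugate of \<open>P\<close> intertwines \<open>J\<close> with its conjugate, so it only
  links eigenvalues that are conjugate to each other; a conjugation-equivariant function of the
  diagonal of \<open>J\<close> therefore yields a matrix fixed by conjugation.\<close>

lemma real_functional_calculus:
  fixes A :: "real ^ 'n ^ 'n" and P P' J :: "complex ^ 'n ^ 'n"
  assumes PP': "P ** P' = mat 1" "P' ** P = mat 1"
    and A: "map_matrix complex_of_real A = P ** J ** P'" and J: "split_triangular r J"
    and g: "\<And>z. g (cnj z) = cnj (g z)"
  obtains G where "map_matrix complex_of_real G = P ** (\<chi> i j. if i = j then g (J $ i $ i) else 0) ** P'"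
proof -
  let ?C = "map_matrix cnj :: complex ^ 'n ^ 'n \<Rightarrow> _"
  define D where "D = (\<chi> i j. if i = j then g (J $ i $ i) else 0)"
  \<comment> \<open>\<open>Q\<close> records how far \<open>P\<close> is from being real:
    \<open>?C P\<close> equals \<open>P ** Q\<close>.\<close>
  define Q where "Q = P' ** ?C P"
  define X where "X = P ** D ** P'"
  have C: "?C (U ** V) = ?C U ** ?C V" for U V
    by (rule map_matrix_mult) auto
  have C1: "?C (mat 1) = mat 1"
    by (auto simp: vec_eq_iff mat_def)
  have CP: "?C P ** ?C P' = mat 1" "?C P' ** ?C P = mat 1"
    using PP' C C1 by metis+
  \<comment> \<open>\<open>A\<close> is real, hence fixed by conjugation; this yields the
    intertwining relation \<open>JQ\<close>.\<close>
  have "?C (P ** J ** P') = P ** J ** P'"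
    unfolding A[symmetric] by (simp add: vec_eq_iff)
  then have "P' ** (?C P ** ?C J ** ?C P') ** ?C P = P' ** (P ** J ** P') ** ?C P"
    by (simp add: C)
  moreover have "P' ** (?C P ** ?C J ** ?C P') ** ?C P = Q ** ?C J ** (?C P' ** ?C P)"
    by (simp add: Q_def matrix_mul_assoc)
  moreover have "P' ** (P ** J ** P') ** ?C P = (P' ** P) ** J ** Q"
    by (simp add: Q_def matrix_mul_assoc)
  ultimately have JQ: "J ** Q = Q ** ?C J"
    by (simp add: PP' CP)
  have "split_triangular r (?C J)"
    using J by (simp add: split_triangular_def)
  then have "J $ i $ i = cnj (J $ j $ j)" if "Q $ i $ j \<noteq> 0" for i j
    using intertwiner_entry_zero[OF J _ JQ] that by fastforce
  then have "g (J $ i $ i) * Q $ i $ j = Q $ i $ j * cnj (g (J $ j $ j))" for i j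
    using g by (cases "Q $ i $ j = 0") auto
  then have DQ: "D ** Q = Q ** ?C D"
    by (simp add: D_def matrix_matrix_mult_def vec_eq_iff if_distrib if_distribR cong: if_cong)
  \<comment> \<open>Writing \<open>?C P\<close> as \<open>P ** Q\<close> and moving \<open>D\<close>
    across \<open>Q\<close> by \<open>DQ\<close> shows that \<open>?C X\<close> and \<open>X\<close>
    agree after multiplication by the invertible \<open>?C P\<close>.\<close>
  have "?C X ** ?C P = ?C P ** ?C D ** (?C P' ** ?C P)"
    by (simp add: X_def C matrix_mul_assoc)
  also have "\<dots> = (P ** P') ** ?C P ** ?C D"
    by (simp add: CP PP')
  also have "\<dots> = P ** (Q ** ?C D)"
    by (simp add: Q_def matrix_mul_assoc)
  also have "\<dots> = X ** ?C P"
    by (simp add: DQ[symmetric]) (simp add: Q_def X_def matrix_mul_assoc)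
  finally have "?C X ** (?C P ** ?C P') = X ** (?C P ** ?C P')"
    by (simp add: matrix_mul_assoc)
  then have "cnj (X $ i $ j) = X $ i $ j" for i j
    by (simp add: CP vec_eq_iff)
  then have "map_matrix complex_of_real (map_matrix Re X) = X"
    by (simp add: vec_eq_iff complex_eq_iff)
  then show thesis
    using that by (simp add: X_def D_def)
qed

section \<open>Polydiscs in eigencoordinates\<close>

text \<open>On \<open>K\<close> the off-diagonal part of \<open>J\<close> changes each coordinate by
  at most \<open>e\<close>. Thus \<open>K + T K\<close> and \<open>S K\<close> each lie in the other
  dilated by \<open>1 + e\<close>, which costs a factor \<open>(1 + e) ^ CARD('n)\<close> in volume.
  For \<open>e = 0\<close> the two bounds give equality.\<close>

lemma polydisc_sumset_estimate:
  fixes T :: "real ^ 'n \<Rightarrow> real ^ 'n" and P P' J :: "complex ^ 'n ^ 'n"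
  assumes T: "linear T" and PP': "P ** P' = mat 1" "P' ** P = mat 1"
    and TJ: "complexified_matrix T = P ** J ** P'" and J: "split_triangular r J"
    and e: "\<And>i. (\<Sum>j\<in>UNIV - {i}. cmod (J $ i $ j)) \<le> e" "0 \<le> e"
  obtains K where "convex K" "compact K" "measure lebesgue K > 0"
    "measure lebesgue (sum_with_image T K) \<le> (1 + e) ^ CARD('n) * (H_factor T * measure lebesgue K)"
    "H_factor T * measure lebesgue K \<le> (1 + e) ^ CARD('n) * measure lebesgue (sum_with_image T K)"
proof -
  define cv :: "real ^ 'n \<Rightarrow> complex ^ 'n" where "cv v = (\<chi> i. of_real (v $ i))" for v
  define c where "c v = P' *v cv v" for v
  have cv_mult: "cv (B *v v) = map_matrix of_real B *v cv v" for B v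
    by (simp add: cv_def matrix_vector_mult_def vec_eq_iff)
  have cv_add: "cv (u + v) = cv u + cv v" and cv_scale: "cv (t *\<^sub>R v) = t *\<^sub>R cv v" for u v t
    by (auto simp: vec_eq_iff cv_def scaleR_complex.ctr complex_eq_iff)
  have lin: "linear c"
  proof (rule linearI)
    show "c (t *\<^sub>R v) = t *\<^sub>R c v" for t v
      unfolding c_def cv_scale
      by (simp add: vec_eq_iff matrix_vector_mult_def scaleR_sum_right)
  qed (simp add: c_def cv_add matrix_vector_right_distrib)
  interpret c: linear c by (rule lin)
  have inj: "inj c"
  proof (rule injI)
    fix u v assume "c u = c v"
    then have "P *v (P' *v cv u) = P *v (P' *v cv v)"
      by (simp add: c_def)
    then have "cv u = cv v"
      by (simp add: matrix_vector_mul_assoc PP')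
    then show "u = v"
      by (simp add: cv_def vec_eq_iff)
  qed
  \<comment> \<open>A real matrix that complexifies to \<open>P ** M ** P'\<close> acts as
    \<open>M\<close> in the coordinates \<open>c\<close>.\<close>
  have c_conj: "c (B *v v) = M *v c v" if "map_matrix complex_of_real B = P ** M ** P'" for B M v
  proof -
    have "c (B *v v) = P' *v ((P ** M ** P') *v cv v)"
      by (simp add: c_def cv_mult that)
    also have "\<dots> = ((P' ** P) ** M) *v (P' *v cv v)"
      by (simp add: matrix_vector_mul_assoc matrix_mul_assoc)
    finally show ?thesis
      by (simp add: PP' c_def)
  qed
  have TA: "T v = matrix T *v v" for v
    using T by (simp add: matrix_works)
  have c_T: "c (T v) $ i = J $ i $ i * c v $ i + (\<Sum>j\<in>UNIV - {i}. J $ i $ j * c v $ j)" for v i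
  proof -
    have "c (matrix T *v v) = J *v c v"
      by (rule c_conj) (rule TJ[unfolded complexified_matrix_def])
    then have "c (T v) $ i = (\<Sum>j\<in>UNIV. J $ i $ j * c v $ j)"
      by (simp only: TA) (simp add: matrix_vector_mult_def)
    also have "(\<Sum>j\<in>UNIV. J $ i $ j * c v $ j)
        = J $ i $ i * c v $ i + (\<Sum>j\<in>UNIV - {i}. J $ i $ j * c v $ j)"
      by (rule sum.remove) auto
    finally show ?thesis .
  qed
  define K where "K = {v. \<forall>i. cmod (c v $ i) \<le> 1}"
  have off: "cmod (\<Sum>j\<in>UNIV - {i}. J $ i $ j * c v $ j) \<le> e" if "v \<in> K" for v i
  proof -
    have "cmod (\<Sum>j\<in>UNIV - {i}. J $ i $ j * c v $ j) \<le> (\<Sum>j\<in>UNIV - {i}. cmod (J $ i $ j))"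
      using that by (intro sum_norm_le) (simp add: norm_mult K_def mult_left_le)
    with e(1)[of i] show ?thesis
      by linarith
  qed
  have fc: "\<exists>G. map_matrix complex_of_real G = P ** (\<chi> i j. if i = j then g (J $ i $ i) else 0) ** P' \<and>
      (\<forall>v i. c (G *v v) $ i = g (J $ i $ i) * c v $ i)"
    if g: "\<And>z. g (cnj z) = cnj (g z)" for g
  proof -
    obtain G where G: "map_matrix complex_of_real G
        = P ** (\<chi> i j. if i = j then g (J $ i $ i) else 0) ** P'"
      using real_functional_calculus[where g = g, OF PP' TJ[unfolded complexified_matrix_def] J g] .
    moreover have "c (G *v v) $ i = g (J $ i $ i) * c v $ i" for v i
      unfolding c_conj[OF G] by (simp add: matrix_vector_mult_def if_distribR if_distrib cong: if_cong)
    ultimately show ?thesis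
      by blast
  qed
  obtain S where SP: "map_matrix complex_of_real S
      = P ** (\<chi> i j. if i = j then complex_of_real (1 + cmod (J $ i $ i)) else 0) ** P'"
    and cS: "\<And>v i. c (S *v v) $ i = complex_of_real (1 + cmod (J $ i $ i)) * c v $ i"
    using fc[of "\<lambda>z. complex_of_real (1 + cmod z)"] by auto
  \<comment> \<open>\<open>S'\<close> is the inverse of \<open>S\<close>, built by the same
    calculus.\<close>
  obtain S' where cS': "\<And>v i. c (S' *v v) $ i = complex_of_real (1 / (1 + cmod (J $ i $ i))) * c v $ i"
    using fc[of "\<lambda>z. complex_of_real (1 / (1 + cmod z))"] by auto
  \<comment> \<open>\<open>U\<close> undoes the phase of each eigenvalue, since
    \<open>z * cnj (sgn z)\<close> is \<open>cmod z\<close>. At eigenvalue 0 it kills the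
    coordinate, as \<open>sgn 0 = 0\<close>; this is harmless because moduli need only stay at most
    1.\<close>
  obtain U where cU: "\<And>v i. c (U *v v) $ i = cnj (sgn (J $ i $ i)) * c v $ i"
    using fc[of "\<lambda>z. cnj (sgn z)"] by (auto simp: complex_sgn_def)
  have H: "H_factor T = (\<Prod>i\<in>UNIV. 1 + cmod (J $ i $ i))"
    using PP' TJ
  proof (rule H_factor_triangularised)
    show "inj r"
      using J by (simp add: split_triangular_def)
    show "r i \<le> r j" if "J $ i $ j \<noteq> 0" for i j
      using split_triangularD(1)[OF J that] by (cases "i = j") auto
  qed
  have pos: "1 + cmod z > 0" for z
    using norm_ge_zero[of z] by linarith
  have "complex_of_real (det S) = det P * det P' * complex_of_real (H_factor T)"
    by (simp add: det_map_of_real[symmetric] SP det_mul det_diagonal_UNIV H)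
  moreover have "det P * det P' = 1"
    using PP' by (metis det_I det_mul)
  ultimately have detS: "det S = H_factor T"
    by (metis mult_1 of_real_eq_iff)
  have H_pos: "H_factor T > 0"
    unfolding H by (intro prod_pos) (simp add: pos)
  have SS': "S *v (S' *v v) = v" for v
  proof (rule injD[OF inj])
    have "1 + complex_of_real (cmod z) \<noteq> 0" for z
      using pos[of z] by (metis of_real_1 of_real_add of_real_eq_0_iff less_irrefl)
    then show "c (S *v (S' *v v)) = c v"
      by (simp add: vec_eq_iff cS cS')
  qed
  have L: "(*v) S ` K = {v. \<forall>i. cmod (c v $ i) \<le> 1 + cmod (J $ i $ i)}" (is "_ = ?L")
  proof (intro subset_antisym subsetI)
    fix v assume "v \<in> (*v) S ` K"
    then show "v \<in> ?L"
      using pos by (auto simp: cS K_def norm_mult abs_of_pos mult_le_cancel_left1 simp del: of_real_add)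
  next
    fix v assume "v \<in> ?L"
    then have "S' *v v \<in> K"
      using pos by (simp add: cS' K_def norm_mult abs_of_pos divide_le_eq_1 norm_divide del: of_real_add)
    then show "v \<in> (*v) S ` K"
      using SS' by (metis image_eqI)
  qed
  have cont: "continuous_on UNIV (\<lambda>v. c v $ i)" for i
    by (intro continuous_intros linear_continuous_on linear_conv_bounded_linear[THEN iffD1] lin)
  have K_conv: "convex K"
  proof (rule convexI)
    fix x y and u v :: real assume *: "x \<in> K" "y \<in> K" "0 \<le> u" "0 \<le> v" "u + v = 1"
    have "cmod (c (u *\<^sub>R x + v *\<^sub>R y) $ i) \<le> 1" for i
    proof -
      have "cmod (u *\<^sub>R c x $ i + v *\<^sub>R c y $ i) \<le> u * cmod (c x $ i) + v * cmod (c y $ i)"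
        using * by (intro norm_triangle_le) simp
      also have "\<dots> \<le> 1"
        using * by (intro convex_bound_le) (auto simp: K_def)
      finally show ?thesis
        by (simp add: c.add c.scale)
    qed
    then show "u *\<^sub>R x + v *\<^sub>R y \<in> K"
      by (simp add: K_def)
  qed
  have K_comp: "compact K"
    unfolding compact_eq_bounded_closed
  proof
    \<comment> \<open>An injective linear map is bounded below, so bounded coordinates force bounded
      vectors.\<close>
    obtain B where B: "B > 0" "\<And>x. B * norm x \<le> norm (c x)"
      using linear_inj_bounded_below_pos[OF lin inj] by blast
    have "norm v \<le> CARD('n) / B" if "v \<in> K" for v
    proof -
      have "norm (c v) \<le> (\<Sum>i\<in>UNIV. cmod (c v $ i))"
        unfolding norm_vec_def by (rule L2_set_le_sum) simp
      also have "\<dots> \<le> CARD('n)"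
        using sum_bounded_above[of UNIV "\<lambda>i. cmod (c v $ i)" 1] that by (simp add: K_def)
      finally show ?thesis
        using B(2)[of v] B(1) by (simp add: field_simps)
    qed
    then show "bounded K"
      by (rule boundedI)
    have "closed {v. cmod (c v $ i) \<le> 1}" for i
      by (intro closed_Collect_le continuous_intros cont)
    then show "closed K"
      unfolding K_def by (rule closed_Collect_all)
  qed
  have K_pos: "measure lebesgue K > 0"
  proof -
    \<comment> \<open>The strict inequalities define an open set around 0, so \<open>K\<close>
      contains a ball.\<close>
    let ?O = "\<Inter>i. {v. cmod (c v $ i) < 1}"
    have "open ?O"
      by (intro open_INT finite ballI open_Collect_less continuous_intros cont)
    moreover have "0 \<in> ?O"
      by (simp add: c.zero)
    ultimately obtain d where d: "d > 0" "ball 0 d \<subseteq> ?O"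
      by (meson openE)
    have "ball 0 d \<subseteq> K"
      using d(2) by (auto simp: K_def subset_iff less_imp_le)
    then have "measure lebesgue (ball (0 :: real ^ 'n) d) \<le> measure lebesgue K"
      using K_comp by (intro measure_mono_fmeasurable) (auto simp: lmeasurable_compact)
    moreover have "measure lebesgue (ball (0 :: real ^ 'n) d) > 0"
      using d(1) by (simp add: content_ball_pos)
    ultimately show ?thesis
      by linarith
  qed
  have K_mble: "K \<in> lmeasurable"
    using K_comp by (rule lmeasurable_compact)
  have L_meas: "(*v) S ` K \<in> lmeasurable"
    "measure lebesgue ((*v) S ` K) = H_factor T * measure lebesgue K"
    using measure_linear_image_finite[OF matrix_vector_mul_linear K_mble, of S] H_pos
    by (simp_all add: detS)
  define A where "A = sum_with_image T K"
  have "A = {x + y |x y. x \<in> K \<and> y \<in> T ` K}"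
    by (auto simp: A_def sum_with_image_def)
  then have "compact A" if "compact (T ` K)"
    using compact_sums[OF K_comp that] by simp
  moreover have "compact (T ` K)"
    using K_comp T by (intro compact_continuous_image linear_continuous_on)
      (simp_all add: linear_conv_bounded_linear)
  ultimately have A_mble: "A \<in> lmeasurable"
    by (blast intro: lmeasurable_compact)
  have scale: "(\<lambda>x. (1 + e) *\<^sub>R x) ` X \<in> lmeasurable \<and>
      measure lebesgue ((\<lambda>x. (1 + e) *\<^sub>R x) ` X) = (1 + e) ^ CARD('n) * measure lebesgue X"
    if "X \<in> lmeasurable" for X :: "(real ^ 'n) set"
    using measure_linear_image_finite[OF linear_scaleR that, of "1 + e"]
      measure_lebesgue_affine[of "1 + e" 0 X] e(2) by simp
  \<comment> \<open>Coordinate \<open>i\<close> of \<open>x + T y\<close> has modulus at most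
    \<open>1 + cmod (J $ i $ i) + e\<close>, which is at most
    \<open>(1 + e) * (1 + cmod (J $ i $ i))\<close>.\<close>
  have "A \<subseteq> (\<lambda>x. (1 + e) *\<^sub>R x) ` (*v) S ` K"
  proof
    fix z assume "z \<in> A"
    then obtain x y where xy: "x \<in> K" "y \<in> K" "z = x + T y"
      by (auto simp: A_def sum_with_image_def)
    have "cmod (c ((1 / (1 + e)) *\<^sub>R z) $ i) \<le> 1 + cmod (J $ i $ i)" for i
    proof -
      have "cmod (c z $ i) \<le> cmod (c x $ i) + cmod (J $ i $ i * c y $ i)
          + cmod (\<Sum>j\<in>UNIV - {i}. J $ i $ j * c y $ j)"
        unfolding xy c.add vector_add_component c_T by norm
      also have "\<dots> \<le> 1 + cmod (J $ i $ i) + e"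
        using xy off[of y i] by (intro add_mono) (auto simp: K_def norm_mult mult_left_le)
      also have "\<dots> \<le> (1 + e) * (1 + cmod (J $ i $ i))"
        using e(2) by (simp add: algebra_simps)
      finally show ?thesis
        using e(2) by (simp add: c.scale divide_le_eq mult.commute)
    qed
    then have "(1 / (1 + e)) *\<^sub>R z \<in> (*v) S ` K"
      unfolding L by simp
    moreover have "z = (1 + e) *\<^sub>R ((1 / (1 + e)) *\<^sub>R z)"
      using e(2) by simp
    ultimately show "z \<in> (\<lambda>x. (1 + e) *\<^sub>R x) ` (*v) S ` K"
      by (rule rev_image_eqI)
  qed
  then have "measure lebesgue A \<le> measure lebesgue ((\<lambda>x. (1 + e) *\<^sub>R x) ` (*v) S ` K)"
    using scale[OF L_meas(1)] A_mble by (intro measure_mono_fmeasurable) (auto simp: fmeasurableD)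
  then have upper: "measure lebesgue A \<le> (1 + e) ^ CARD('n) * (H_factor T * measure lebesgue K)"
    using scale[OF L_meas(1)] L_meas(2) by simp
  have "(*v) S ` K \<subseteq> (\<lambda>x. (1 + e) *\<^sub>R x) ` A"
  proof (rule image_subsetI)
    fix u assume u: "u \<in> K"
    \<comment> \<open>With this \<open>y\<close> the diagonal part of \<open>T y\<close> contributes
      exactly \<open>cmod (J $ i $ i)\<close> times coordinate \<open>i\<close> of \<open>u\<close>.
      So \<open>x\<close> differs from \<open>u\<close> only by the off-diagonal error, at most
      \<open>e\<close> per coordinate.\<close>
    define y where "y = U *v u"
    define x where "x = S *v u - T y"
    have "cmod (cnj (sgn z)) \<le> 1" for z
      by (simp add: norm_sgn)
    then have "cmod (c y $ i) \<le> 1" for i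
      using u by (simp only: y_def cU norm_mult K_def mem_Collect_eq) (simp add: mult_le_one)
    then have y: "y \<in> K"
      by (simp add: K_def)
    have "z * cnj (sgn z) = cmod z" for z
    proof -
      have "z * cnj (sgn z) = (z * cnj z) / cmod z"
        by (simp add: sgn_eq)
      then show ?thesis
        by (simp add: complex_norm_square[symmetric] power2_eq_square)
    qed
    then have "c x $ i = c u $ i - (\<Sum>j\<in>UNIV - {i}. J $ i $ j * c y $ j)" for i
      unfolding x_def c.diff vector_minus_component c_T cS y_def cU mult.assoc[symmetric]
      by (simp add: algebra_simps)
    then have "cmod (c x $ i) \<le> cmod (c u $ i) + cmod (\<Sum>j\<in>UNIV - {i}. J $ i $ j * c y $ j)" for i
      by (simp add: norm_triangle_ineq4)
    moreover have u1: "cmod (c u $ i) \<le> 1" and y1: "cmod (c y $ i) \<le> 1" for i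
      using u y by (simp_all add: K_def)
    ultimately have "cmod (c x $ i) \<le> 1 + e" for i
      using off[OF y, of i] by (meson add_mono order_trans)
    then have x: "(1 / (1 + e)) *\<^sub>R x \<in> K"
      using e(2) by (simp add: K_def c.scale divide_le_eq)
    \<comment> \<open>\<open>y\<close> is already in \<open>K\<close>, but it must be shrunk along
      with \<open>x\<close> for \<open>S *v u\<close> to be a dilated point of
      \<open>A\<close>.\<close>
    have y': "(1 / (1 + e)) *\<^sub>R y \<in> K"
    proof -
      have "cmod (c y $ i) \<le> 1 + e" for i
        using y1[of i] e(2) by linarith
      then show ?thesis
        using e(2) by (simp add: K_def c.scale divide_le_eq)
    qed
    have "S *v u = (1 + e) *\<^sub>R ((1 / (1 + e)) *\<^sub>R x + T ((1 / (1 + e)) *\<^sub>R y))"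
      using e(2) T by (simp add: linear_scale scaleR_add_right x_def)
    then show "S *v u \<in> (\<lambda>x. (1 + e) *\<^sub>R x) ` A"
      using x y' by (auto simp: A_def sum_with_image_def)
  qed
  then have "measure lebesgue ((*v) S ` K) \<le> measure lebesgue ((\<lambda>x. (1 + e) *\<^sub>R x) ` A)"
    using scale[OF A_mble] L_meas(1) by (intro measure_mono_fmeasurable) (auto simp: fmeasurableD)
  then have lower: "H_factor T * measure lebesgue K \<le> (1 + e) ^ CARD('n) * measure lebesgue A"
    using scale[OF A_mble] L_meas(2) by simp
  show thesis
    using that[OF K_conv K_comp K_pos] upper lower by (simp add: A_def)
qed

section \<open>Shrinking the off-diagonal entries\<close>

text \<open>Conjugation by the diagonal matrix of the \<open>t ^ r i\<close> multiplies entry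
  \<open>(i, j)\<close> by \<open>t ^ (r j - r i)\<close>. Off the diagonal a nonzero entry has
  \<open>r i < r j\<close>, so the factor is at most \<open>t\<close>, while the diagonal stays
  fixed.\<close>

lemma off_diagonal_rescaling:
  fixes P P' J :: "complex ^ 'n ^ 'n" and e :: real
  assumes PP': "P ** P' = mat 1" "P' ** P = mat 1" and J: "split_triangular r J" and e: "e > 0"
  obtains R R' M where "R ** R' = mat 1" "R' ** R = mat 1" "P ** J ** P' = R ** M ** R'"
    "split_triangular r M" "\<And>i. (\<Sum>j\<in>UNIV - {i}. cmod (M $ i $ j)) \<le> e"
proof -
  define B where "B = (\<Sum>i\<in>UNIV. \<Sum>j\<in>UNIV. cmod (J $ i $ j))"
  \<comment> \<open>The bound 1 keeps higher powers of \<open>t\<close> below \<open>t\<close>; the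
    quotient makes \<open>t * B \<le> e\<close>, and \<open>1 + B\<close> is positive even if
    \<open>J\<close> is 0.\<close>
  define t where "t = min 1 (e / (1 + B))"
  have B0: "B \<ge> 0"
    unfolding B_def by (intro sum_nonneg) simp
  have t: "0 < t" "t \<le> 1" "t * B \<le> e"
  proof -
    show "0 < t" "t \<le> 1"
      using e B0 by (simp_all add: t_def)
    have "t * B \<le> e / (1 + B) * (1 + B)"
      using e B0 by (intro mult_mono) (auto simp: t_def)
    then show "t * B \<le> e"
      using B0 by simp
  qed
  define d :: "'n \<Rightarrow> complex" where "d i = complex_of_real t ^ r i" for i
  have d0: "d i \<noteq> 0" for i
    using t by (simp add: d_def)
  define E :: "complex ^ 'n ^ 'n" where "E = (\<chi> i j. if i = j then d i else 0)"
  define E' :: "complex ^ 'n ^ 'n" where "E' = (\<chi> i j. if i = j then 1 / d i else 0)"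
  have EE': "E ** E' = mat 1" "E' ** E = mat 1"
    using d0 by (simp_all add: E_def E'_def matrix_matrix_mult_def mat_def vec_eq_iff
        mult_delta_left mult_delta_right)
  define M where "M = E' ** J ** E"
  have M: "M $ i $ j = J $ i $ j * (d j / d i)" for i j
    by (simp add: M_def E_def E'_def matrix_matrix_mult_def mult_delta_left mult_delta_right)
  have M_diag: "M $ i $ i = J $ i $ i" for i
    using d0 by (simp add: M)
  have M_off: "cmod (M $ i $ j) \<le> t * cmod (J $ i $ j)" if "i \<noteq> j" for i j
  proof (cases "J $ i $ j = 0")
    case False
    then have "r i < r j"
      using split_triangularD(1)[OF J] that by blast
    then obtain k where "r j = r i + Suc k"
      using less_iff_Suc_add[of "r i" "r j"] by auto
    then have "cmod (d j / d i) = t * t ^ k"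
      using t by (simp add: d_def norm_divide norm_mult norm_power power_add)
    also have "\<dots> \<le> t"
      using t by (simp add: mult_left_le power_le_one)
    finally show ?thesis
      unfolding M norm_mult mult.commute[of t] by (rule mult_left_mono) simp
  qed (simp add: M)
  show thesis
  proof (rule that)
    show "(P ** E) ** (E' ** P') = mat 1"
    proof -
      have "(P ** E) ** (E' ** P') = P ** (E ** E') ** P'"
        by (simp add: matrix_mul_assoc)
      then show ?thesis
        by (simp add: EE' PP')
    qed
    show "(E' ** P') ** (P ** E) = mat 1"
    proof -
      have "(E' ** P') ** (P ** E) = E' ** (P' ** P) ** E"
        by (simp add: matrix_mul_assoc)
      then show ?thesis
        by (simp add: EE' PP')
    qed
    show "P ** J ** P' = (P ** E) ** M ** (E' ** P')"
    proof -
      have "(P ** E) ** M ** (E' ** P') = P ** (E ** E') ** J ** (E ** E') ** P'"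
        by (simp add: M_def matrix_mul_assoc)
      then show ?thesis
        by (simp add: EE')
    qed
    show "split_triangular r M"
      using J unfolding split_triangular_def M_diag by (auto simp: M)
    show "(\<Sum>j\<in>UNIV - {i}. cmod (M $ i $ j)) \<le> e" for i
    proof -
      have "(\<Sum>j\<in>UNIV - {i}. cmod (M $ i $ j)) \<le> (\<Sum>j\<in>UNIV - {i}. t * cmod (J $ i $ j))"
        by (intro sum_mono M_off) auto
      also have "\<dots> \<le> (\<Sum>j\<in>UNIV. t * cmod (J $ i $ j))"
        using t by (intro sum_mono2) auto
      also have "\<dots> = t * (\<Sum>j\<in>UNIV. cmod (J $ i $ j))"
        by (simp add: sum_distrib_left)
      also have "\<dots> \<le> t * B"
      proof (rule mult_left_mono)
        show "(\<Sum>j\<in>UNIV. cmod (J $ i $ j)) \<le> B"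
          unfolding B_def by (rule member_le_sum) (auto intro: sum_nonneg)
      qed (use t in simp)
      finally show ?thesis
        using t(3) by linarith
    qed
  qed
qed

section \<open>Exact equality for diagonal form and the limit in general\<close>

theorem mainTheorem3:
  fixes T :: "real ^ 'n \<Rightarrow> real ^ 'n"
  assumes "linear T"
  shows "(diagonalizable_over_complex T \<longrightarrow>
            (\<exists>K :: (real ^ 'n) set. convex K \<and> compact K \<and> measure lebesgue K > 0 \<and>
               measure lebesgue (sum_with_image T K) = H_factor T * measure lebesgue K)) \<and>
         (\<exists>K :: nat \<Rightarrow> (real ^ 'n) set.
            (\<forall>m. convex (K m) \<and> compact (K m) \<and> measure lebesgue (K m) > 0) \<and>
            (\<lambda>m. measure lebesgue (sum_with_image T (K m)) / measure lebesgue (K m))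
              \<longlonglongrightarrow> H_factor T)"
proof (intro conjI impI)
  assume "diagonalizable_over_complex T"
  then obtain P D :: "complex ^ 'n ^ 'n" where P: "invertible P" and D: "\<And>i j. i \<noteq> j \<Longrightarrow> D $ i $ j = 0"
    and T: "complexified_matrix T = P ** D ** matrix_inv P"
    by (auto simp: diagonalizable_over_complex_def)
  have P_inv: "P ** matrix_inv P = mat 1 \<and> matrix_inv P ** P = mat 1"
    using someI_ex[OF P[unfolded invertible_def]] by (simp add: matrix_inv_def)
  \<comment> \<open>Any injective rank will do: a diagonal matrix has no off-diagonal entries to
    order.\<close>
  obtain r :: "'n \<Rightarrow> nat" where "inj r"
    using finite_imp_inj_to_nat_seg[OF finite[of "UNIV :: 'n set"]] by auto
  then have "split_triangular r D"
    using D by (auto simp: split_triangular_def)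
  then obtain K where "convex K" "compact K" "measure lebesgue K > 0"
    "measure lebesgue (sum_with_image T K) \<le> (1 + 0) ^ CARD('n) * (H_factor T * measure lebesgue K)"
    "H_factor T * measure lebesgue K \<le> (1 + 0) ^ CARD('n) * measure lebesgue (sum_with_image T K)"
    by (rule polydisc_sumset_estimate[OF assms P_inv[THEN conjunct1] P_inv[THEN conjunct2] T, of r 0]) (auto simp: D)
  then show "\<exists>K. convex K \<and> compact K \<and> measure lebesgue K > 0 \<and>
      measure lebesgue (sum_with_image T K) = H_factor T * measure lebesgue K"
    by (intro exI[of _ K]) simp
next
  let ?q = "\<lambda>K. measure lebesgue (sum_with_image T K) / measure lebesgue K"
  \<comment> \<open>The estimate is applied with \<open>e\<close> equal to
    \<open>1 / (m + 1)\<close>, so the quotient \<open>?q\<close> is squeezed between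
    \<open>H_factor T\<close> divided and multiplied by \<open>?a m\<close>, which tends to
    1.\<close>
  let ?a = "\<lambda>m. (1 + inverse (real (Suc m))) ^ CARD('n)"
  obtain P P' J and r :: "'n \<Rightarrow> nat"
    where PP': "P ** P' = mat 1" "P' ** P = mat 1" and T: "complexified_matrix T = P ** J ** P'"
      and J: "split_triangular r J"
    using jordan_form_exists[of "complexified_matrix T"] by metis
  have "\<exists>K. convex K \<and> compact K \<and> measure lebesgue K > 0 \<and>
      ?q K \<le> ?a m * H_factor T \<and> H_factor T / ?a m \<le> ?q K" for m
  proof -
    have pos: "inverse (real (Suc m)) > 0"
      by simp
    obtain R R' M where R: "R ** R' = mat 1" "R' ** R = mat 1" "P ** J ** P' = R ** M ** R'"
      "split_triangular r M" "\<And>i. (\<Sum>j\<in>UNIV - {i}. cmod (M $ i $ j)) \<le> inverse (real (Suc m))"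
      using off_diagonal_rescaling[OF PP' J pos] by blast
    obtain K where K: "convex K" "compact K" "measure lebesgue K > 0"
      and le: "measure lebesgue (sum_with_image T K) \<le> ?a m * (H_factor T * measure lebesgue K)"
        "H_factor T * measure lebesgue K \<le> ?a m * measure lebesgue (sum_with_image T K)"
      using polydisc_sumset_estimate[OF assms R(1,2) T[unfolded R(3)] R(4,5) less_imp_le[OF pos]] .
    have a_pos: "?a m > 0"
      using pos by (intro zero_less_power) linarith
    have "?q K \<le> ?a m * H_factor T"
      using le(1) by (simp only: pos_divide_le_eq[OF K(3)] mult_ac)
    moreover have "H_factor T / ?a m \<le> ?q K"
      using le(2) by (simp only: pos_divide_le_eq[OF a_pos] times_divide_eq_left times_divide_eq_right
          pos_le_divide_eq[OF K(3)] mult_ac)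
    ultimately show ?thesis
      using K by blast
  qed
  then obtain K where K: "\<And>m. convex (K m)" "\<And>m. compact (K m)" "\<And>m. measure lebesgue (K m) > 0"
    and le: "\<And>m. ?q (K m) \<le> ?a m * H_factor T" "\<And>m. H_factor T / ?a m \<le> ?q (K m)"
    by metis
  have a: "?a \<longlonglongrightarrow> (1 + 0) ^ CARD('n)"
    by (intro tendsto_intros LIMSEQ_inverse_real_of_nat)
  have "(\<lambda>m. ?q (K m)) \<longlonglongrightarrow> H_factor T"
  proof (rule tendsto_sandwich)
    show "(\<lambda>m. H_factor T / ?a m) \<longlonglongrightarrow> H_factor T"
      using tendsto_divide[OF tendsto_const a, of "H_factor T"] by simp
    show "(\<lambda>m. ?a m * H_factor T) \<longlonglongrightarrow> H_factor T"
      using tendsto_mult_right[OF a, of "H_factor T"] by simp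
  qed (use le in auto)
  with K show "\<exists>K. (\<forall>m. convex (K m) \<and> compact (K m) \<and> measure lebesgue (K m) > 0) \<and>
      (\<lambda>m. ?q (K m)) \<longlonglongrightarrow> H_factor T"
    by blast
qed

end
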